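(* Let $0<q<p\le1$, $k\in\mathbb{Z}$, $n\ge0$, let $s$ be a nonnegative integer and $u\ne1$. Then $$E_{n,p,q}^{(k)}(x)=\sum_{l=0}^n\frac{\binom nl}{(1-u)^s} \sum_{i=0}^s\binom si (-u)^{s-i}H_l^{(s)}(x;u)\,E_{n-l,p,q}^{(k)}(i).$$
   Context: $[n]_{p,q}=\frac{p^n-q^n}{p-q}$; $\mathrm{Li}_{k,p,q}(t)=\sum_{n\ge1} t^n/[n]_{p,q}^k$. The $(p,q)$-poly-Euler polynomials are defined by $\frac{2\,\mathrm{Li}_{k,p,q}(1-e^{-t})}{1+e^{t}}e^{xt}=\sum_{n\ge0} E_{n,p,q}^{(k)}(x)\frac{t^n}{n!}$. The Frobenius–Euler functions are defined by $\left(\frac{1-u}{e^t-u}\right)^s e^{xt}=\sum_{n\ge0}H_n^{(s)}(x;u)\frac{t^n}{n!}$. *)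

theory Defs
  imports Complex_Main "HOL-Computational_Algebra.Formal_Power_Series"
begin

definition pq_number :: "real \<Rightarrow> real \<Rightarrow> nat \<Rightarrow> real" where
  "pq_number p q n = (p ^ n - q ^ n) / (p - q)"

text \<open>All generating functions are formal power series over the complex numbers
  in the variable \<open>t\<close>; \<open>fps_exp c\<close> is \<open>e\<^bsup>ct\<^esup>\<close>.\<close>

definition pq_polylog_fps :: "int \<Rightarrow> real \<Rightarrow> real \<Rightarrow> complex fps" where
  "pq_polylog_fps k p q =
     Abs_fps (\<lambda>n. if n = 0 then 0 else 1 / complex_of_real (pq_number p q n) powi k)"

definition pq_poly_Euler_fps :: "int \<Rightarrow> real \<Rightarrow> real \<Rightarrow> complex \<Rightarrow> complex fps" where
  "pq_poly_Euler_fps k p q x =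
     2 * (pq_polylog_fps k p q oo (1 - fps_exp (- 1))) / (1 + fps_exp 1) * fps_exp x"

definition pq_poly_Euler :: "nat \<Rightarrow> real \<Rightarrow> real \<Rightarrow> int \<Rightarrow> complex \<Rightarrow> complex" where
  "pq_poly_Euler n p q k x = fact n * fps_nth (pq_poly_Euler_fps k p q x) n"

text \<open>For \<open>u \<noteq> 1\<close> the denominator below has constant term \<open>1 - u \<noteq> 0\<close>, so the
  quotient is the genuine one in the ring of power series.\<close>

definition Frobenius_Euler_fps :: "nat \<Rightarrow> complex \<Rightarrow> complex \<Rightarrow> complex fps" where
  "Frobenius_Euler_fps s x u =
     (fps_const (1 - u) / (fps_exp 1 - fps_const u)) ^ s * fps_exp x"

definition Frobenius_Euler :: "nat \<Rightarrow> nat \<Rightarrow> complex \<Rightarrow> complex \<Rightarrow> complex" where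
  "Frobenius_Euler n s x u = fact n * fps_nth (Frobenius_Euler_fps s x u) n"

end

theory Submission
  imports Defs
begin

text \<open>Multiplying the generating function of the Frobenius--Euler functions by
  \<open>(e\<^sup>t - u)\<^sup>s\<close> leaves \<open>(1 - u)\<^sup>s e\<^bsup>xt\<^esup>\<close>. Expanding
  \<open>(e\<^sup>t - u)\<^sup>s\<close> binomially, each power \<open>e\<^bsup>it\<^esup>\<close> shifts the argument of
  the poly-Euler generating function to \<open>i\<close>; the theorem compares coefficients.\<close>

unbundle fps_syntax

text \<open>The argument enters the generating function only through the factor
  \<open>fps_exp x\<close>, so the series at \<open>of_nat i\<close> is the series at
  \<open>0\<close> times \<open>fps_exp 1 ^ i\<close>. The sum is then the binomial expansion with
  second term \<open>- u\<close>.\<close>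

lemma pq_poly_Euler_fps_binomial:
  "(\<Sum>i=0..s. fps_const (of_nat (s choose i) * (- u) ^ (s - i)) *
      pq_poly_Euler_fps k p q (of_nat i)) =
   pq_poly_Euler_fps k p q 0 * (fps_exp 1 - fps_const u) ^ s"
proof -
  have "(fps_exp 1 - fps_const u) ^ s = (fps_exp 1 + fps_const (- u)) ^ s"
    by (simp flip: fps_const_neg)
  also have "\<dots> = (\<Sum>i\<le>s. of_nat (s choose i) * fps_exp 1 ^ i * fps_const (- u) ^ (s - i))"
    by (rule binomial_ring)
  also have "\<dots> = (\<Sum>i=0..s. fps_const (of_nat (s choose i) * (- u) ^ (s - i)) *
      fps_exp (of_nat i))"
    by (simp only: atMost_atLeast0 fps_exp_power_mult fps_const_power fps_of_nat [symmetric]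
          fps_const_mult [symmetric] mult_1_right mult.assoc) (simp add: mult.commute)
  finally show ?thesis
    by (simp add: pq_poly_Euler_fps_def sum_distrib_left mult_ac)
qed

text \<open>The constant term \<open>1 - u\<close> of the denominator is nonzero, so the denominator
  is a unit and the quotient cancels exactly.\<close>

lemma Frobenius_Euler_fps_mult_power:
  assumes "u \<noteq> 1"
  shows "Frobenius_Euler_fps s x u * (fps_exp 1 - fps_const u) ^ s =
    fps_const ((1 - u) ^ s) * fps_exp x"
proof -
  let ?d = "fps_exp 1 - fps_const u"
  have "?d $ 0 \<noteq> 0"
    using assms by simp
  then have "?d dvd fps_const (1 - u)"
    by (meson fps_is_unit_iff unit_imp_dvd)
  then have "fps_const (1 - u) / ?d * ?d = fps_const (1 - u)"
    by (rule dvd_div_mult_self)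
  then have "(fps_const (1 - u) / ?d) ^ s * ?d ^ s = fps_const ((1 - u) ^ s)"
    by (metis power_mult_distrib fps_const_power)
  then show ?thesis
    by (simp add: Frobenius_Euler_fps_def mult_ac)
qed

theorem theorem7:
  fixes p q :: real and k :: int and n s :: nat and u x :: complex
  assumes "0 < q" and "q < p" and "p \<le> 1" and "u \<noteq> 1"
  shows "pq_poly_Euler n p q k x =
    (\<Sum>l=0..n. of_nat (n choose l) / (1 - u) ^ s *
      (\<Sum>i=0..s. of_nat (s choose i) * (- u) ^ (s - i) *
        Frobenius_Euler l s x u * pq_poly_Euler (n - l) p q k (of_nat i)))"
proof -
  \<comment> \<open>\<open>S\<close> carries the whole sum over \<open>i\<close>, so that the sum
    over \<open>l\<close> becomes the Cauchy product of \<open>?F\<close> and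
    \<open>S\<close>.\<close>
  define S where "S = (\<Sum>i=0..s. fps_const (of_nat (s choose i) * (- u) ^ (s - i)) *
      pq_poly_Euler_fps k p q (of_nat i))"
  let ?F = "Frobenius_Euler_fps s x u"
  have "?F * S = pq_poly_Euler_fps k p q 0 * (?F * (fps_exp 1 - fps_const u) ^ s)"
    unfolding S_def pq_poly_Euler_fps_binomial by (simp only: mult_ac)
  \<comment> \<open>The factor \<open>fps_exp x\<close> left over from \<open>?F\<close> moves the
    argument from \<open>0\<close> to \<open>x\<close>.\<close>
  also have "\<dots> = fps_const ((1 - u) ^ s) * pq_poly_Euler_fps k p q x"
    by (simp only: Frobenius_Euler_fps_mult_power [OF \<open>u \<noteq> 1\<close>])
      (simp add: pq_poly_Euler_fps_def mult_ac)
  finally have "(1 - u) ^ s * (pq_poly_Euler_fps k p q x $ n) = (\<Sum>l=0..n. ?F $ l * S $ (n - l))"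
    by (metis fps_mult_left_const_nth fps_mult_nth)
  then have "pq_poly_Euler_fps k p q x $ n = (\<Sum>l=0..n. ?F $ l * S $ (n - l)) / (1 - u) ^ s"
    using \<open>u \<noteq> 1\<close> by (simp add: field_simps)
  then have "pq_poly_Euler n p q k x =
      (\<Sum>l=0..n. fact n * (?F $ l * S $ (n - l)) / (1 - u) ^ s)"
    by (simp add: pq_poly_Euler_def sum_distrib_left sum_divide_distrib)
  also have "\<dots> = (\<Sum>l=0..n. of_nat (n choose l) / (1 - u) ^ s *
      (\<Sum>i=0..s. of_nat (s choose i) * (- u) ^ (s - i) *
        Frobenius_Euler l s x u * pq_poly_Euler (n - l) p q k (of_nat i)))"
  proof (rule sum.cong [OF refl])
    fix l assume "l \<in> {0..n}"
    \<comment> \<open>Since \<open>l \<le> n\<close>, the factorial splits: \<open>fact l\<close>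
      and \<open>fact (n - l)\<close> turn the two series coefficients into function values, and the
      binomial coefficient remains.\<close>
    then have "fact n = (fact l * fact (n - l) * of_nat (n choose l) :: complex)"
      by (simp add: binomial_fact)
    moreover have "(\<Sum>i=0..s. of_nat (s choose i) * (- u) ^ (s - i) *
        Frobenius_Euler l s x u * pq_poly_Euler (n - l) p q k (of_nat i)) =
        fact l * fact (n - l) * (?F $ l * S $ (n - l))"
      by (simp add: S_def fps_sum_nth Frobenius_Euler_def pq_poly_Euler_def
          sum_distrib_left mult_ac)
    ultimately show "fact n * (?F $ l * S $ (n - l)) / (1 - u) ^ s =
        of_nat (n choose l) / (1 - u) ^ s *
        (\<Sum>i=0..s. of_nat (s choose i) * (- u) ^ (s - i) *
          Frobenius_Euler l s x u * pq_poly_Euler (n - l) p q k (of_nat i))"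
      by (simp only: times_divide_eq_left times_divide_eq_right mult_ac)
  qed
  finally show ?thesis .
qed

end
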